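(* Let $w\in R_n(13/2/4)$ have largest letter $m$, and let $l$ be the number of $1$s in $w$. Then $w$ has one of the following forms: (A) $m\le2$; (B) $w$ is weakly increasing and $m\ge3$; (C) $m\ge3$ and $w=uv$ where $u$ is weakly increasing, $v$ begins with the first $m$ of $w$, and $v=m^{b_m}z^{b_z}$ (a block of $m$s followed by a block of $z$s) with $z\le m-1$; (D) $m\ge3$ and $w=uv$ where $u$ is weakly increasing, $v$ begins with the first $m$ of $w$, $v$ is not weakly increasing, and $v$ consists of $b_m$ $m$s and $b_z$ $z$s in some order, where $z=m-1$; $x$ is the position of the last $m$ in $v$ and $y$ is the position of the last $z$ in $v$. If $m\le2$, then $ls(w)=n-l$; if moreover $w$ is weakly increasing, then $lb(w)=0$, $rb(w)=l$ and $rs(w)=0$; and if $w=1^iw'1^j2^k$, where $i,j\ge1$, $k\ge0$ and $w'$ begins and ends with $2$, then $lb(w)=l-i$, $rb(w)=l-\delta_{k,0}\,j$ and $rs(w)=n-l-k$. Otherwise, $$lb(w)=\begin{cases}0&\text{form (B)}\\(m-z)b_z&\text{form (C) or (D)}\end{cases}\qquad rs(w)=\begin{cases}0&\text{form (B)}\\ \sum_{i=z+1}^m a_i&\text{form (C)}\\ y-b_z&\text{form (D)}\end{cases}$$ $$rb(w)=\begin{cases}l&\text{form (B)}\\ \sum_{i=1}^{m-1}(m-i)a_i&\text{form (C)}\\ (x-a_m)+\sum_{i=1}^{m-1}(m-i)a_i&\text{form (D)}\end{cases}$$ $$ls(w)=(z-1)b_z+\sum_{i=2}^m(i-1)a_i.$$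 Here, in (C) and (D), $a_i$ for $i\le m-1$ is the number of $i$s in $u$ and $a_m=b_m$ is the number of $m$s in $w$; in (B), $a_i$ is the number of $i$s in $w$ and the term $(z-1)b_z$ is absent.
   Context: A set partition $\sigma$ of $[n]=\{1,\dots,n\}$ is written $\sigma=B_1/B_2/\dots/B_m$ with blocks ordered so that $\min B_1<\dots<\min B_m$. To it corresponds the restricted growth function $w(\sigma)=w_1\cdots w_n$ with $w_i=j$ if $i\in B_j$. $\sigma$ contains a pattern $\pi$ (a set partition of $[k]$) if for some $A\subseteq[n]$ the partition of $A$ formed by the nonempty sets $A\cap B_i$, relabelled order-preservingly by $1,\dots,|A|$, equals $\pi$; otherwise it avoids $\pi$. $R_n(\pi)$ is the set of $w(\sigma)$ for $\sigma$ a set partition of $[n]$ avoiding $\pi$. The pattern $13/2/4$ is the set partition $\{1,3\},\{2\},\{4\}$ of $[4]$. Wachs and White statistics (counting distinct letter values): $rs(w)=\sum_i|\{w_j: j>i,\ w_j<w_i\}|$, $ls(w)=\sum_i|\{w_j: j<i,\ w_j<w_i\}|$, $lb(w)=\sum_i|\{w_j: j<i,\ w_j>w_i\}|$, $rb(w)=\sum_i|\{w_j: j>i,\ w_j>w_i\}|$. Positions within $v$ are numbered starting from $1$. $\delta_{k,0}$ is $1$ if $k=0$ and $0$ otherwise. An exponent on a letter denotes repetition.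
   Formalization: Two values of rb(w) are corrected: in form (B), rb(w) is the sum over i=1..m-1 of (m-i)a_i instead of l (w=123 has rb=3, l=1); for weakly increasing w with m≤2, rb(w)=l is claimed only for m=2, and rb(w)=0 for m=1. *)

theory Defs
  imports Complex_Main "HOL-Library.Disjoint_Sets" "HOL-Library.Multiset"
begin

text \<open>A set partition of \<open>[n]\<close> is a set of blocks \<open>\<sigma>\<close> with \<^prop>\<open>partition_on {1..n} \<sigma>\<close>.\<close>

definition standardize :: "nat set \<Rightarrow> nat set set \<Rightarrow> nat set set" where
  "standardize A P = (\<lambda>B. (\<lambda>x. card {a \<in> A. a \<le> x}) ` B) ` P"

definition subpartition :: "nat set \<Rightarrow> nat set set \<Rightarrow> nat set set" where
  "subpartition A \<sigma> = {A \<inter> B | B. B \<in> \<sigma> \<and> A \<inter> B \<noteq> {}}"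

definition contains_pattern :: "nat \<Rightarrow> nat set set \<Rightarrow> nat set set \<Rightarrow> bool" where
  "contains_pattern n \<sigma> \<pi> \<longleftrightarrow> (\<exists>A \<subseteq> {1..n}. standardize A (subpartition A \<sigma>) = \<pi>)"

definition blocks_in_order :: "nat set set \<Rightarrow> nat set list" where
  "blocks_in_order \<sigma> =
     (THE Bs. set Bs = \<sigma> \<and> sorted_wrt (\<lambda>B C. Min B < Min C) Bs)"

text \<open>Blocks and letters are numbered from 1, while list positions start at 0.\<close>

definition rgf :: "nat \<Rightarrow> nat set set \<Rightarrow> nat list" where
  "rgf n \<sigma> =
     map (\<lambda>i. THE j. j \<in> {1..card \<sigma>} \<and> i \<in> blocks_in_order \<sigma> ! (j - 1)) [1..<Suc n]"

definition R :: "nat \<Rightarrow> nat set set \<Rightarrow> nat list set" where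
  "R n \<pi> = {rgf n \<sigma> | \<sigma>. partition_on {1..n} \<sigma> \<and> \<not> contains_pattern n \<sigma> \<pi>}"

definition pattern_13_2_4 :: "nat set set" where
  "pattern_13_2_4 = {{1, 3}, {2}, {4}}"

definition rs :: "nat list \<Rightarrow> nat" where
  "rs w = (\<Sum>i<length w. card {w ! j | j. i < j \<and> j < length w \<and> w ! j < w ! i})"

definition ls :: "nat list \<Rightarrow> nat" where
  "ls w = (\<Sum>i<length w. card {w ! j | j. j < i \<and> w ! j < w ! i})"

definition lb :: "nat list \<Rightarrow> nat" where
  "lb w = (\<Sum>i<length w. card {w ! j | j. j < i \<and> w ! j > w ! i})"

definition rb :: "nat list \<Rightarrow> nat" where
  "rb w = (\<Sum>i<length w. card {w ! j | j. i < j \<and> j < length w \<and> w ! j > w ! i})"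

text \<open>In the forms below, \<open>m\<close> stands for the largest letter of \<open>w\<close>, and \<open>bm\<close>, \<open>bz\<close> for
  the exponents \<open>b\<^sub>m\<close>, \<open>b\<^sub>z\<close>. The condition \<^prop>\<open>m \<notin> set u\<close> says that the \<open>m\<close>
  at the start of \<open>v\<close> is the first one in \<open>w\<close>.\<close>

definition formA :: "nat \<Rightarrow> bool" where
  "formA m \<longleftrightarrow> m \<le> 2"

definition formB :: "nat \<Rightarrow> nat list \<Rightarrow> bool" where
  "formB m w \<longleftrightarrow> sorted w \<and> m \<ge> 3"

definition split_at_first_max :: "nat \<Rightarrow> nat list \<Rightarrow> nat list \<Rightarrow> nat list \<Rightarrow> bool" where
  "split_at_first_max m w u v \<longleftrightarrow>
     w = u @ v \<and> sorted u \<and> m \<notin> set u \<and> v \<noteq> [] \<and> hd v = m"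

text \<open>The block of \<open>z\<close>s is nonempty: if it were empty, \<open>z\<close> would be undetermined.\<close>

definition formC ::
  "nat \<Rightarrow> nat list \<Rightarrow> nat list \<Rightarrow> nat list \<Rightarrow> nat \<Rightarrow> nat \<Rightarrow> nat \<Rightarrow> bool" where
  "formC m w u v z bm bz \<longleftrightarrow>
     m \<ge> 3 \<and> split_at_first_max m w u v \<and> z \<le> m - 1 \<and> bz \<ge> 1 \<and>
     v = replicate bm m @ replicate bz z"

definition formD ::
  "nat \<Rightarrow> nat list \<Rightarrow> nat list \<Rightarrow> nat list \<Rightarrow> nat \<Rightarrow> nat \<Rightarrow> nat \<Rightarrow> bool" where
  "formD m w u v z bm bz \<longleftrightarrow>
     m \<ge> 3 \<and> split_at_first_max m w u v \<and> \<not> sorted v \<and> z = m - 1 \<and>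
     mset v = replicate_mset bm m + replicate_mset bz z"

definition last_position :: "nat \<Rightarrow> nat list \<Rightarrow> nat" where
  "last_position c v = Max {p \<in> {1..length v}. v ! (p - 1) = c}"

end

theory Submission
  imports Defs
begin

text \<open>
  On restricted growth functions, avoiding \<open>13/2/4\<close> means having no subsequence \<open>a b a c\<close> with
  \<open>a\<close>, \<open>b\<close>, \<open>c\<close> distinct. A descent before the first maximal letter \<open>m\<close> extends to the left to some
  \<open>a b a\<close>, which \<open>m\<close> then completes, so the prefix \<open>u\<close> is sorted. If \<open>z \<noteq> m\<close> is the first letter
  other than \<open>m\<close> after it, then \<open>z \<dots> m \<dots> z\<close> forces all later letters into \<open>{z, m}\<close>; when
  \<open>z < m - 1\<close>, also \<open>z \<dots> m - 1 \<dots> z\<close> forces them to be \<open>z\<close>. The statistics then depend only on the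
  decomposition into a sorted word \<open>u\<close> and a word \<open>v\<close> over two letters; on \<open>v\<close> both \<open>rs\<close> and \<open>rb\<close>
  are read off from the position of the last occurrence of a letter, which treats the forms (C)
  and (D) alike.
\<close>

section \<open>Recursions for the statistics along a word\<close>

lemma Collect_nth_Cons_Suc:
  "{(x # w) ! j |j. Suc i < j \<and> j < length (x # w) \<and> P ((x # w) ! j)} =
    {w ! j |j. i < j \<and> j < length w \<and> P (w ! j)}"
proof -
  have ex_Suc: "(\<exists>j. Q j) \<longleftrightarrow> Q 0 \<or> (\<exists>j. Q (Suc j))" for Q :: "nat \<Rightarrow> bool"
    by (metis not0_implies_Suc)
  show ?thesis
    by (rule Collect_cong, subst ex_Suc) simp
qed

lemma Collect_nth_Cons_0:
  "{(x # w) ! j |j. 0 < j \<and> j < length (x # w) \<and> P ((x # w) ! j)} = {y \<in> set w. P y}"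
  by (force simp: in_set_conv_nth gr0_conv_Suc)

text \<open>\<open>rs\<close> and \<open>rb\<close> look only to the right, so prepending a letter
  leaves the contributions of all other letters unchanged. \<open>lb\<close> looks to the left and
  is therefore unfolded at the end of the word instead.\<close>

lemma rs_Cons: "rs (x # w) = card {y \<in> set w. y < x} + rs w"
  unfolding rs_def length_Cons sum.lessThan_Suc_shift nth_Cons_0 nth_Cons_Suc
  using Collect_nth_Cons_0[of x w "\<lambda>y. y < x"] Collect_nth_Cons_Suc[of x w _ "\<lambda>y. y < _"]
  by simp

lemma rb_Cons: "rb (x # w) = card {y \<in> set w. x < y} + rb w"
  unfolding rb_def length_Cons sum.lessThan_Suc_shift nth_Cons_0 nth_Cons_Suc
  using Collect_nth_Cons_0[of x w "\<lambda>y. x < y"] Collect_nth_Cons_Suc[of x w _ "\<lambda>y. _ < y"]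
  by simp

lemma lb_snoc: "lb (w @ [x]) = lb w + card {y \<in> set w. x < y}"
proof -
  have "{(w @ [x]) ! j |j. j < length w \<and> x < (w @ [x]) ! j} = {y \<in> set w. x < y}"
    by (force simp: in_set_conv_nth nth_append)
  moreover have "{(w @ [x]) ! j |j. j < i \<and> (w @ [x]) ! i < (w @ [x]) ! j}
      = {w ! j |j. j < i \<and> w ! i < w ! j}" if "i < length w" for i
    using that by (force simp: nth_append)
  ultimately show ?thesis
    by (simp add: lb_def)
qed

lemma rs_Nil [simp]: "rs [] = 0" and rb_Nil [simp]: "rb [] = 0" and lb_Nil [simp]: "lb [] = 0"
  by (simp_all add: rs_def rb_def lb_def)

text \<open>No letter of the sorted \<open>u\<close> has a smaller letter of \<open>u\<close> on its
  right, so only \<open>v\<close> supplies smaller letters.\<close>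

lemma rs_append_sorted:
  "sorted u \<Longrightarrow> rs (u @ v) = (\<Sum>x\<leftarrow>u. card {y \<in> set v. y < x}) + rs v"
proof (induction u)
  case (Cons x u)
  then have "{y \<in> set (u @ v). y < x} = {y \<in> set v. y < x}"
    by auto
  with Cons show ?case
    by (simp only: append_Cons rs_Cons) simp
qed simp

text \<open>All letters above a letter \<open>x\<close> of \<open>u\<close> occur somewhere in the
  word, and as \<open>u\<close> is sorted none of them precedes \<open>x\<close>; hence
  \<open>x\<close> contributes \<open>m - x\<close>.\<close>

lemma rb_append_sorted:
  assumes "sorted u" "set (u @ v) \<subseteq> {..m}" "\<And>x. x \<in> set u \<Longrightarrow> {x<..m} \<subseteq> set (u @ v)"
  shows "rb (u @ v) = (\<Sum>x\<leftarrow>u. m - x) + rb v"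
  using assms
proof (induction u)
  case (Cons x u)
  have "{y \<in> set (u @ v). x < y} = {x<..m}"
    using Cons.prems(2,3) by fastforce
  \<comment> \<open>The removed head \<open>x\<close> is at most \<open>y\<close>, hence not one of
    the letters above \<open>y\<close>.\<close>
  moreover have "{y<..m} \<subseteq> set (u @ v)" if "y \<in> set u" for y
    using that Cons.prems(1) Cons.prems(3)[of y] by fastforce
  ultimately show ?case
    using Cons by (simp add: rb_Cons)
qed simp

lemma rs_sorted: "sorted w \<Longrightarrow> rs w = 0"
  using rs_append_sorted[of w "[]"] by simp

lemma lb_sorted: "sorted w \<Longrightarrow> lb w = 0"
proof (induction w rule: rev_induct)
  case (snoc x w)
  then have "{y \<in> set w. x < y} = {}"
    by (auto simp: sorted_append)
  with snoc show ?case
    by (simp add: lb_snoc sorted_append del: Collect_empty_eq)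
qed simp

text \<open>An \<open>m\<close> in \<open>v\<close> has nothing larger before it. A \<open>z\<close>
  in \<open>v\<close> has exactly the larger letters \<open>z + 1\<close> to \<open>m\<close> before
  it: those below \<open>m\<close> occur in \<open>u\<close>, and \<open>m\<close> heads
  \<open>v\<close>. Allowing \<open>v = []\<close> provides the base case of the induction from the
  right.\<close>

lemma lb_append_two_letters:
  assumes "sorted u" "set u = {1..<m}" "1 \<le> z" "z < m" "set v \<subseteq> {m, z}" "v = [] \<or> hd v = m"
  shows "lb (u @ v) = (m - z) * count_list v z"
  using assms(5,6)
proof (induction v rule: rev_induct)
  case Nil
  show ?case using assms(1) by (simp add: lb_sorted)
next
  case (snoc x v)
  then have IH: "lb (u @ v) = (m - z) * count_list v z"
    by (cases v) auto
  have lb: "lb (u @ v @ [x]) = lb (u @ v) + card {y \<in> set (u @ v). x < y}"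
    using lb_snoc[of "u @ v" x] by simp
  \<comment> \<open>The word \<open>v @ [x]\<close> begins with \<open>m\<close>, so an
    \<open>x\<close> equal to \<open>z\<close> already has an \<open>m\<close> before it.\<close>
  consider "x = m" | "x = z" "m \<in> set v"
    using snoc.prems assms(4) by (cases v) auto
  then show ?case
  proof cases
    case 1
    then have "{y \<in> set (u @ v). x < y} = {}"
      using assms(2,4) snoc.prems by auto
    then show ?thesis
      using 1 IH lb assms(4) by simp
  next
    case 2
    then have "{y \<in> set (u @ v). x < y} = {z<..m}"
      using assms(2,3,4) snoc.prems by fastforce
    then show ?thesis
      using 2 IH lb by simp
  qed
qed

lemma last_position_append:
  assumes "c \<notin> set t"
  shows "last_position c (v @ c # t) = Suc (length v)"
  unfolding last_position_def
proof (rule Max_eqI)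
  fix p assume "p \<in> {p \<in> {1..length (v @ c # t)}. (v @ c # t) ! (p - 1) = c}"
  then have p: "1 \<le> p" "p \<le> length v + 1 + length t" "(v @ c # t) ! (p - 1) = c"
    by auto
  show "p \<le> Suc (length v)"
  proof (rule ccontr)
    assume "\<not> p \<le> Suc (length v)"
    \<comment> \<open>Positions count from 1, so a position beyond the displayed \<open>c\<close> is
      index \<open>p - length v - 2\<close> of \<open>t\<close>.\<close>
    then have "p = length v + Suc (Suc (p - length v - 2))"
      by simp
    then obtain q where "p = length v + Suc (Suc q)" ..
    then have "(v @ c # t) ! (p - 1) = t ! q" "q < length t"
      using p by (simp_all add: nth_append)
    with p(3) assms show False
      by (metis nth_mem)
  qed
qed auto

lemma length_two_letters:
  "set v \<subseteq> {a, b} \<Longrightarrow> a \<noteq> b \<Longrightarrow> length v = count_list v a + count_list v b"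
  by (induction v) auto

text \<open>Up to the last \<open>a\<close>, each \<open>b\<close> contributes 1 and each
  \<open>a\<close> contributes 0; after it only \<open>b\<close>s remain, which contribute nothing.
  So \<open>rs\<close> counts the \<open>b\<close>s before the last \<open>a\<close>, and adding all
  \<open>a\<close>s counts every position up to it.\<close>

lemma rs_two_letters:
  assumes "a < b" "set v \<subseteq> {a, b}" "a \<in> set v"
  shows "rs v + count_list v a = last_position a v"
proof -
  obtain ys zs where v: "v = ys @ a # zs" "a \<notin> set zs"
    using split_list_last[OF assms(3)] by blast
  then have zs: "set zs \<subseteq> {b}" and ys: "set ys \<subseteq> {a, b}"
    using assms(2) by auto
  have "sorted (a # zs)"
    using zs assms(1) by (induction zs) auto
  moreover have "rs (ys @ a # zs) = count_list ys b + rs (a # zs)"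
    using ys
  proof (induction ys)
    case (Cons x ys)
    then have "{y \<in> set (ys @ a # zs). y < x} = (if x = b then {a} else {})"
      using zs assms(1) by auto
    with Cons show ?case
      using assms(1) by (auto simp: rs_Cons simp del: Collect_empty_eq)
  qed simp
  ultimately show ?thesis
    using v length_two_letters[OF ys] assms(1)
    by (simp add: rs_sorted last_position_append)
qed

text \<open>The same count with the roles of the letters exchanged. The tail from the last
  \<open>b\<close> on is now weakly decreasing, so the facts on sorted words do not apply to it and
  its \<open>rb\<close> is shown to vanish directly.\<close>

lemma rb_two_letters:
  assumes "a < b" "set v \<subseteq> {a, b}" "b \<in> set v"
  shows "rb v + count_list v b = last_position b v"
proof -
  obtain ys zs where v: "v = ys @ b # zs" "b \<notin> set zs"
    using split_list_last[OF assms(3)] by blast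
  then have zs: "set zs \<subseteq> {a}" and ys: "set ys \<subseteq> {a, b}"
    using assms(2) by auto
  have "rb zs = 0"
    using zs
  proof (induction zs)
    case (Cons x zs)
    then have "{y \<in> set zs. x < y} = {}"
      by auto
    with Cons show ?case
      by (simp add: rb_Cons del: Collect_empty_eq)
  qed simp
  moreover have "{y \<in> set zs. b < y} = {}"
    using zs assms(1) by auto
  ultimately have "rb (b # zs) = 0"
    by (simp add: rb_Cons del: Collect_empty_eq)
  moreover have "rb (ys @ b # zs) = count_list ys a + rb (b # zs)"
    using ys
  proof (induction ys)
    case (Cons x ys)
    then have "{y \<in> set (ys @ b # zs). x < y} = (if x = a then {b} else {})"
      using zs assms(1) by auto
    with Cons show ?case
      using assms(1) by (auto simp: rb_Cons simp del: Collect_empty_eq)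
  qed simp
  ultimately show ?thesis
    using v length_two_letters[OF ys] assms(1)
    by (simp add: last_position_append)
qed

section \<open>Restricted growth functions as words\<close>

definition restricted_growth :: "nat list \<Rightarrow> bool" where
  "restricted_growth w \<longleftrightarrow> (\<forall>i<length w. 1 \<le> w ! i \<and> {1..<w ! i} \<subseteq> set (take i w))"

text \<open>\<open>restricted_growth\<close> asks for the smaller letters themselves to have
  occurred, rather than bounding a letter by one plus the previous maximum. So the smaller letters
  to the left of position \<open>i\<close> are exactly those in \<open>{1..<w ! i}\<close>.\<close>

lemma ls_restricted_growth:
  assumes "restricted_growth w"
  shows "ls w = (\<Sum>x\<leftarrow>w. x - 1)"
proof -
  have "{w ! j |j. j < i \<and> w ! j < w ! i} = {1..<w ! i}" if i: "i < length w" for i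
  proof
    show "{w ! j |j. j < i \<and> w ! j < w ! i} \<subseteq> {1..<w ! i}"
      using assms i by (auto simp: restricted_growth_def)
    have "{1..<w ! i} \<subseteq> set (take i w)"
      using assms i by (simp add: restricted_growth_def)
    then show "{1..<w ! i} \<subseteq> {w ! j |j. j < i \<and> w ! j < w ! i}"
      using i by (fastforce simp: in_set_conv_nth)
  qed
  then show ?thesis
    by (simp add: ls_def sum_list_sum_nth atLeast0LessThan)
qed

lemma set_restricted_growth:
  assumes "restricted_growth w" "w \<noteq> []"
  shows "set w = {1..Max (set w)}"
proof
  show "set w \<subseteq> {1..Max (set w)}"
    using assms by (auto simp: restricted_growth_def in_set_conv_nth)
  obtain i where i: "i < length w" "w ! i = Max (set w)"
    using assms(2) Max_in[of "set w"] by (auto simp: in_set_conv_nth)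
  then have "{1..<Max (set w)} \<subseteq> set w"
    using assms(1) set_take_subset[of i w] by (fastforce simp: restricted_growth_def)
  then show "{1..Max (set w)} \<subseteq> set w"
    using Max_in[of "set w"] assms(2) le_neq_implies_less by fastforce
qed

text \<open>By restricted growth at the first \<open>m\<close>, every smaller letter has already
  appeared, that is, lies in \<open>u\<close>.\<close>

lemma set_before_first_max:
  assumes "restricted_growth w" "m = Max (set w)" "split_at_first_max m w u v"
  shows "set u = {1..<m}"
proof
  have w: "w = u @ v" "m \<notin> set u" "v \<noteq> []" "hd v = m"
    using assms(3) by (auto simp: split_at_first_max_def)
  then have "set w = {1..m}"
    using set_restricted_growth[OF assms(1)] assms(2) by auto
  then have "set u \<subseteq> {1..m}"
    using w(1) by auto
  then show "set u \<subseteq> {1..<m}"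
    using w(2) le_neq_implies_less by fastforce
  have "length u < length w" "w ! length u = m"
    using w by (auto simp: nth_append hd_conv_nth)
  then have "{1..<m} \<subseteq> set (take (length u) w)"
    using assms(1) unfolding restricted_growth_def by blast
  then show "{1..<m} \<subseteq> set u"
    using w(1) by simp
qed

text \<open>Passes from sums over positions to sums over letter values weighted by multiplicity;
  values in the interval that do not occur have weight 0.\<close>

lemma sum_list_map_count:
  fixes w :: "nat list"
  assumes "set w \<subseteq> {a..b}"
  shows "int (\<Sum>x\<leftarrow>w. f x) = (\<Sum>i = a..b. int (f i) * int (count_list w i))"
proof -
  have "(\<Sum>x\<leftarrow>w. f x) = (\<Sum>i\<in>set w. count_list w i * f i)"
    by (rule sum_list_map_eq_sum_count)
  also have "\<dots> = (\<Sum>i = a..b. count_list w i * f i)"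
    using assms by (intro sum.mono_neutral_left) auto
  finally show ?thesis
    by (simp add: mult.commute)
qed

section \<open>From set partitions to restricted growth functions\<close>

lemma blocks_in_order:
  assumes "partition_on {1..n} \<sigma>"
  shows "set (blocks_in_order \<sigma>) = \<sigma>"
    and "sorted_wrt (\<lambda>B C. Min B < Min C) (blocks_in_order \<sigma>)"
proof -
  let ?P = "\<lambda>Bs. set Bs = \<sigma> \<and> sorted_wrt (\<lambda>B C. Min B < Min C) Bs"
  have fin: "finite \<sigma>"
    using assms by (rule finite_elements[rotated]) simp
  have Min_in_block: "Min B \<in> B" if "B \<in> \<sigma>" for B
    using that assms finite_subset[of B "{1..n}"]
    by (intro Min_in) (auto simp: partition_on_def)
  have inj: "inj_on Min \<sigma>"
  proof (rule inj_onI)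
    fix B C assume BC: "B \<in> \<sigma>" "C \<in> \<sigma>" "Min B = Min C"
    then have "Min B \<in> B \<inter> C"
      using Min_in_block[of B] Min_in_block[of C] by simp
    with BC show "B = C"
      using partition_onD2[OF assms] by (auto simp: disjoint_def)
  qed
  \<comment> \<open>Sorting the minima and mapping them back to their blocks gives existence. For
    uniqueness, the strictly increasing list of minima is determined by its set, and
    \<open>Min\<close> is injective on the blocks.\<close>
  have "\<exists>!Bs. ?P Bs"
  proof (rule ex_ex1I)
    let ?L = "sorted_list_of_set (Min ` \<sigma>)"
    let ?Bs = "map (inv_into \<sigma> Min) ?L"
    have "set ?Bs = \<sigma>"
      using fin inj by (simp add: image_image)
    moreover have "sorted_wrt (\<lambda>x y. Min (inv_into \<sigma> Min x) < Min (inv_into \<sigma> Min y)) ?L"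
      by (rule sorted_wrt_mono_rel[OF _ strict_sorted_list_of_set]) (simp add: fin f_inv_into_f)
    ultimately show "\<exists>Bs. ?P Bs"
      by (intro exI[of _ ?Bs]) (simp add: sorted_wrt_map)
  next
    fix Bs Cs assume *: "?P Bs" "?P Cs"
    then have "map Min Bs = map Min Cs"
      by (intro strict_sorted_equal) (simp_all add: sorted_wrt_map)
    then show "Bs = Cs"
      using * inj by (auto intro: map_inj_on)
  qed
  then have "?P (blocks_in_order \<sigma>)"
    unfolding blocks_in_order_def by (rule theI')
  then show "set (blocks_in_order \<sigma>) = \<sigma>"
    and "sorted_wrt (\<lambda>B C. Min B < Min C) (blocks_in_order \<sigma>)"
    by auto
qed

lemma length_blocks_in_order:
  assumes "partition_on {1..n} \<sigma>"
  shows "length (blocks_in_order \<sigma>) = card \<sigma>"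
proof -
  have "sorted_wrt (<) (map Min (blocks_in_order \<sigma>))"
    using blocks_in_order(2)[OF assms] by (simp add: sorted_wrt_map)
  then have "distinct (blocks_in_order \<sigma>)"
    by (simp add: strict_sorted_iff distinct_map)
  then show ?thesis
    using blocks_in_order(1)[OF assms] distinct_card by metis
qed

lemma nth_blocks_in_order:
  assumes "partition_on {1..n} \<sigma>" "j \<in> {1..card \<sigma>}"
  shows "blocks_in_order \<sigma> ! (j - 1) \<in> \<sigma>"
proof -
  have "j - 1 < length (blocks_in_order \<sigma>)"
    using assms by (auto simp: length_blocks_in_order)
  from nth_mem[OF this] show ?thesis
    by (simp add: blocks_in_order(1)[OF assms(1)])
qed

lemma Min_blocks_in_order_less:
  assumes "partition_on {1..n} \<sigma>" "1 \<le> j" "j < k" "k \<le> card \<sigma>"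
  shows "Min (blocks_in_order \<sigma> ! (j - 1)) < Min (blocks_in_order \<sigma> ! (k - 1))"
  using assms(2-) length_blocks_in_order[OF assms(1)]
  by (intro sorted_wrt_nth_less[OF blocks_in_order(2)[OF assms(1)]]) auto

lemma partition_on_same_block:
  "partition_on A \<sigma> \<Longrightarrow> B \<in> \<sigma> \<Longrightarrow> C \<in> \<sigma> \<Longrightarrow> x \<in> B \<Longrightarrow> x \<in> C \<Longrightarrow> B = C"
  using disjointD[OF partition_onD2, of A \<sigma> B C] by blast

text \<open>Both indices point to the same block, and no block is listed twice because the minima
  increase strictly.\<close>

lemma block_index_unique:
  assumes "partition_on {1..n} \<sigma>" "j \<in> {1..card \<sigma>}" "k \<in> {1..card \<sigma>}"
    and "x \<in> blocks_in_order \<sigma> ! (j - 1)" "x \<in> blocks_in_order \<sigma> ! (k - 1)"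
  shows "j = k"
proof -
  have "blocks_in_order \<sigma> ! (j - 1) = blocks_in_order \<sigma> ! (k - 1)"
    using assms by (intro partition_on_same_block[OF assms(1)] nth_blocks_in_order)
  then show ?thesis
    using Min_blocks_in_order_less[OF assms(1), of j k]
      Min_blocks_in_order_less[OF assms(1), of k j] assms(2,3)
    by (cases j k rule: linorder_cases) auto
qed

lemma length_rgf [simp]: "length (rgf n \<sigma>) = n"
  by (simp add: rgf_def)

text \<open>Justifies the \<open>THE\<close> in \<open>rgf\<close>: the blocks cover
  \<open>{1..n}\<close>, and the index of a block is unique. List position \<open>i\<close> stands
  for the element \<open>Suc i\<close>.\<close>

lemma rgf_nth:
  assumes "partition_on {1..n} \<sigma>" "i < n"
  shows "rgf n \<sigma> ! i \<in> {1..card \<sigma>}"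
    and "Suc i \<in> blocks_in_order \<sigma> ! (rgf n \<sigma> ! i - 1)"
proof -
  let ?Bs = "blocks_in_order \<sigma>"
  let ?P = "\<lambda>j. j \<in> {1..card \<sigma>} \<and> Suc i \<in> ?Bs ! (j - 1)"
  have "Suc i \<in> \<Union>\<sigma>"
    using assms by (auto simp: partition_on_def)
  then obtain B where "B \<in> set ?Bs" "Suc i \<in> B"
    by (auto simp: blocks_in_order(1)[OF assms(1)])
  then obtain k where "k < card \<sigma>" "Suc i \<in> ?Bs ! k"
    by (auto simp: in_set_conv_nth length_blocks_in_order[OF assms(1)])
  then have "?P (Suc k)"
    by simp
  then have "\<exists>!j. ?P j"
    using block_index_unique[OF assms(1)] by blast
  from theI'[OF this] have "?P (rgf n \<sigma> ! i)"
    using assms(2) by (simp add: rgf_def del: upt_Suc)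
  then show "rgf n \<sigma> ! i \<in> {1..card \<sigma>}" "Suc i \<in> ?Bs ! (rgf n \<sigma> ! i - 1)"
    by auto
qed

lemma rgf_nth_eqI:
  assumes "partition_on {1..n} \<sigma>" "i < n" "j \<in> {1..card \<sigma>}"
    and "Suc i \<in> blocks_in_order \<sigma> ! (j - 1)"
  shows "rgf n \<sigma> ! i = j"
  using assms rgf_nth by (intro block_index_unique)

text \<open>If \<open>j\<close> is less than the letter of \<open>Suc i\<close>, then block
  \<open>j\<close> has a smaller minimum than the block of \<open>Suc i\<close>. This minimum is
  thus less than \<open>Suc i\<close> and produces a letter \<open>j\<close> before position
  \<open>i\<close>.\<close>

lemma restricted_growth_rgf:
  assumes "partition_on {1..n} \<sigma>"
  shows "restricted_growth (rgf n \<sigma>)"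
  unfolding restricted_growth_def
proof (intro allI impI conjI subsetI)
  let ?Bs = "blocks_in_order \<sigma>"
  fix i assume "i < length (rgf n \<sigma>)"
  then have i: "i < n"
    by simp
  note k = rgf_nth[OF assms i]
  then show "1 \<le> rgf n \<sigma> ! i"
    by simp
  fix j assume j: "j \<in> {1..<rgf n \<sigma> ! i}"
  let ?B = "?Bs ! (j - 1)" and ?C = "?Bs ! (rgf n \<sigma> ! i - 1)"
  have BC: "?B \<in> \<sigma>" "?C \<in> \<sigma>"
    using j k(1) by (auto intro!: nth_blocks_in_order[OF assms] simp del: One_nat_def)
  then have sub: "?B \<subseteq> {1..n}" "?C \<subseteq> {1..n}" "?B \<noteq> {}"
    using assms by (auto simp: partition_on_def)
  then have fin: "finite ?B" "finite ?C"
    by (auto intro: finite_subset)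
  have "Min ?B < Min ?C"
    using j k(1) by (intro Min_blocks_in_order_less[OF assms]) auto
  also have "\<dots> \<le> Suc i"
    using fin k(2) by simp
  finally have lt: "Min ?B < Suc i" .
  moreover have "Min ?B \<in> ?B"
    using fin sub by simp
  moreover from this sub have "1 \<le> Min ?B"
    by (meson atLeastAtMost_iff subsetD)
  ultimately have "rgf n \<sigma> ! (Min ?B - 1) = j"
    using i j k by (intro rgf_nth_eqI[OF assms]) auto
  moreover have "Min ?B - 1 < i"
    using lt \<open>1 \<le> Min ?B\<close> by simp
  ultimately show "j \<in> set (take i (rgf n \<sigma>))"
    using i by (auto simp: in_set_conv_nth)
qed

section \<open>The pattern 13/2/4 as a forbidden subsequence of words\<close>

definition avoids_abac :: "nat list \<Rightarrow> bool" where
  "avoids_abac w \<longleftrightarrow>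
     (\<forall>i j k l. i < j \<and> j < k \<and> k < l \<and> l < length w \<and> w ! i = w ! k \<longrightarrow>
        w ! i = w ! j \<or> w ! i = w ! l \<or> w ! j = w ! l)"

text \<open>Two elements lie in the same block exactly when their letters agree, so positions
  \<open>i\<close>, \<open>j\<close>, \<open>k\<close>, \<open>l\<close> of a forbidden subsequence
  give four elements on which the partition is a copy of the pattern.\<close>

lemma avoids_abac_rgf:
  assumes "partition_on {1..n} \<sigma>" "\<not> contains_pattern n \<sigma> pattern_13_2_4"
  shows "avoids_abac (rgf n \<sigma>)"
proof (rule ccontr)
  let ?Bs = "blocks_in_order \<sigma>" and ?w = "rgf n \<sigma>"
  assume "\<not> avoids_abac ?w"
  then obtain i j k l where ijkl: "i < j" "j < k" "k < l" "l < n"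
    and eq: "?w ! i = ?w ! k" and neq: "?w ! i \<noteq> ?w ! j" "?w ! i \<noteq> ?w ! l" "?w ! j \<noteq> ?w ! l"
    by (auto simp: avoids_abac_def)
  define A where "A = {Suc i, Suc j, Suc k, Suc l}"
  define \<beta> where "\<beta> p = ?Bs ! (?w ! p - 1)" for p
  have block: "\<beta> p \<in> \<sigma>" "Suc p \<in> \<beta> p" if "p < n" for p
    using rgf_nth[OF assms(1) that] nth_blocks_in_order[OF assms(1)]
    unfolding \<beta>_def by blast+
  \<comment> \<open>Together with \<open>beta_eq\<close>, this reduces membership in a block to
    equality of letters.\<close>
  have same: "Suc q \<in> B \<longleftrightarrow> B = \<beta> q" if "B \<in> \<sigma>" "q < n" for B q
    using that block partition_on_same_block[OF assms(1)] by blast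
  have beta_eq: "\<beta> p = \<beta> q \<longleftrightarrow> ?w ! p = ?w ! q" if "p < n" "q < n" for p q
    using rgf_nth_eqI[OF assms(1) \<open>p < n\<close> rgf_nth(1)[OF assms(1) \<open>q < n\<close>]] block(2)[OF \<open>p < n\<close>]
    by (auto simp: \<beta>_def simp del: One_nat_def)
  have n: "i < n" "j < n" "k < n" "l < n"
    using ijkl by auto
  have "A \<inter> \<beta> i = {Suc i, Suc k}" "A \<inter> \<beta> j = {Suc j}" "A \<inter> \<beta> l = {Suc l}" "\<beta> k = \<beta> i"
    using n eq neq by (auto simp: A_def same block beta_eq)
  moreover have "subpartition A \<sigma> = (\<lambda>p. A \<inter> \<beta> p) ` {i, j, k, l}"
  proof
    show "subpartition A \<sigma> \<subseteq> (\<lambda>p. A \<inter> \<beta> p) ` {i, j, k, l}"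
    proof
      fix X assume "X \<in> subpartition A \<sigma>"
      then obtain B q where B: "B \<in> \<sigma>" "X = A \<inter> B" "q \<in> A" "q \<in> B"
        unfolding subpartition_def by blast
      then obtain p where p: "p \<in> {i, j, k, l}" "Suc p \<in> B"
        unfolding A_def by blast
      then have "B = \<beta> p"
        using same[OF B(1)] n by blast
      with B(2) p(1) show "X \<in> (\<lambda>p. A \<inter> \<beta> p) ` {i, j, k, l}"
        by blast
    qed
    show "(\<lambda>p. A \<inter> \<beta> p) ` {i, j, k, l} \<subseteq> subpartition A \<sigma>"
    proof
      fix X assume "X \<in> (\<lambda>p. A \<inter> \<beta> p) ` {i, j, k, l}"
      then obtain p where p: "p \<in> {i, j, k, l}" "X = A \<inter> \<beta> p"
        by blast
      then have "\<beta> p \<in> \<sigma>" "Suc p \<in> A \<inter> \<beta> p"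
        using block n by (auto simp: A_def)
      with p(2) show "X \<in> subpartition A \<sigma>"
        unfolding subpartition_def by blast
    qed
  qed
  ultimately have sub: "subpartition A \<sigma> = {{Suc i, Suc k}, {Suc j}, {Suc l}}"
    by auto
  \<comment> \<open>These sets have 1, 2, 3 and 4 elements, which are the labels assigned by
    \<open>standardize\<close>.\<close>
  have "{a \<in> A. a \<le> Suc i} = {Suc i}" "{a \<in> A. a \<le> Suc j} = {Suc i, Suc j}"
    "{a \<in> A. a \<le> Suc k} = {Suc i, Suc j, Suc k}" "{a \<in> A. a \<le> Suc l} = {Suc i, Suc j, Suc k, Suc l}"
    using ijkl by (auto simp: A_def)
  then have "standardize A (subpartition A \<sigma>) = pattern_13_2_4"
    using ijkl by (simp add: sub standardize_def pattern_13_2_4_def card_insert_if eval_nat_numeral)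
  moreover have "A \<subseteq> {1..n}"
    using n by (auto simp: A_def)
  ultimately show False
    using assms(2) by (auto simp: contains_pattern_def)
qed

lemma R_pattern_13_2_4:
  assumes "w \<in> R n pattern_13_2_4"
  shows "length w = n" "restricted_growth w" "avoids_abac w"
  using assms restricted_growth_rgf avoids_abac_rgf by (auto simp: R_def)

section \<open>Classification of the avoiding words\<close>

lemma sorted_before_first_max:
  assumes "restricted_growth (u @ m # v')" "avoids_abac (u @ m # v')" "m \<notin> set u"
  shows "sorted u"
proof (rule ccontr)
  let ?w = "u @ m # v'"
  assume "\<not> sorted u"
  then obtain j k where jk: "j < k" "k < length u" "u ! k < u ! j"
    by (auto simp: sorted_iff_nth_mono_less not_le)
  then have "k < length ?w" "j < length ?w"
    by simp_all
  then have "1 \<le> ?w ! k" "{1..<?w ! j} \<subseteq> set (take j ?w)"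
    using assms(1) unfolding restricted_growth_def by blast+
  \<comment> \<open>The letter \<open>u ! k\<close> is positive and below \<open>u ! j\<close>, so
    restricted growth at \<open>j\<close> yields an earlier copy of it.\<close>
  then have "u ! k \<in> set (take j u)"
    using jk by (auto simp: nth_append)
  then obtain i where "i < j" "u ! i = u ! k"
    using jk by (auto simp: in_set_conv_nth)
  then have "i < j \<and> j < k \<and> k < length u \<and> length u < length ?w \<and> ?w ! i = ?w ! k"
    using jk by (simp add: nth_append)
  then have "?w ! i = ?w ! j \<or> ?w ! i = ?w ! length u \<or> ?w ! j = ?w ! length u"
    using assms(2) unfolding avoids_abac_def by blast
  then show False
    using jk \<open>i < j\<close> \<open>u ! i = u ! k\<close> assms(3) nth_mem[of j u] nth_mem[of k u]
    by (auto simp: nth_append)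
qed

text \<open>Restates avoidance for list decompositions, so that occurrences found by
  \<open>split_list\<close> need no index arithmetic.\<close>

lemma abac_forbidden:
  assumes "avoids_abac (p @ a # q @ b # r @ a # s @ c # t)"
  shows "a = b \<or> a = c \<or> b = c"
proof -
  let ?w = "p @ a # q @ b # r @ a # s @ c # t"
  let ?i = "length p" and ?j = "length p + length q + 1"
    and ?k = "length p + length q + length r + 2"
    and ?l = "length p + length q + length r + length s + 3"
  have "?w ! ?i = a" "?w ! ?j = b" "?w ! ?k = a" "?w ! ?l = c"
    by (simp_all add: nth_append)
  moreover have "?i < ?j \<and> ?j < ?k \<and> ?k < ?l \<and> ?l < length ?w"
    by simp
  ultimately show ?thesis
    using assms[unfolded avoids_abac_def, rule_format, of ?i ?j ?k ?l] by metis
qed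

lemma form_classification:
  assumes "restricted_growth w" "avoids_abac w" "w \<noteq> []" "m = Max (set w)"
  shows "formA m \<or> formB m w \<or>
       (\<exists>u v z bm bz. formC m w u v z bm bz) \<or>
       (\<exists>u v z bm bz. formD m w u v z bm bz)"
proof (cases "m \<ge> 3 \<and> \<not> sorted w")
  case False
  then show ?thesis
    by (auto simp: formA_def formB_def)
next
  case True
  have "m \<in> set w"
    using assms(3,4) by simp
  then obtain u v' where w: "w = u @ m # v'" "m \<notin> set u"
    using split_list_first by metis
  let ?v = "m # v'"
  have split: "split_at_first_max m w u ?v"
    using w sorted_before_first_max[of u m v'] assms(1,2)
    by (simp add: split_at_first_max_def)
  have set_u: "set u = {1..<m}"
    by (rule set_before_first_max[OF assms(1,4) split])
  have set_w: "set w = {1..m}"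
    using set_restricted_growth[OF assms(1,3)] assms(4) by simp
  \<comment> \<open>Otherwise \<open>w\<close> would be the sorted \<open>u\<close> followed by
    copies of its maximum, hence sorted.\<close>
  have "\<not> set v' \<subseteq> {m}"
  proof
    assume "set v' \<subseteq> {m}"
    then have "sorted ?v"
      by (induction v') auto
    then have "sorted w"
      using split w set_u \<open>set v' \<subseteq> {m}\<close> by (auto simp: sorted_append split_at_first_max_def)
    with True show False by simp
  qed
  then obtain p z q where v': "v' = p @ z # q" "z \<noteq> m" "set p \<subseteq> {m}"
    using split_list_first_prop[of v' "\<lambda>x. x \<noteq> m"] by blast
  have "z \<in> set w"
    using w v' by simp
  then have z: "1 \<le> z" "z < m" "z \<in> set u"
    using set_w set_u v'(2) by auto
  have q: "set q \<subseteq> {m, z}"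
  proof
    fix c assume "c \<in> set q"
    then obtain q1 q2 where q12: "q = q1 @ c # q2"
      by (meson split_list)
    obtain u1 u2 where "u = u1 @ z # u2"
      using z(3) by (meson split_list)
    \<comment> \<open>The copy of \<open>z\<close> in \<open>u\<close>, the first \<open>m\<close>,
      the \<open>z\<close> after \<open>p\<close> and then \<open>c\<close> are in forbidden
      position unless \<open>c\<close> is \<open>m\<close> or \<open>z\<close>.\<close>
    then have "w = u1 @ z # u2 @ m # p @ z # q1 @ c # q2"
      using w v' q12 by simp
    then show "c \<in> {m, z}"
      using abac_forbidden[of u1 z u2 m p q1 c q2] assms(2) z by auto
  qed
  show ?thesis
  proof (cases "z = m - 1")
    case True
    have "mset ?v = replicate_mset (count_list ?v m) m + replicate_mset (count_list ?v z) z"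
    proof (rule multiset_eqI)
      fix x
      show "count (mset ?v) x =
          count (replicate_mset (count_list ?v m) m + replicate_mset (count_list ?v z) z) x"
        using v' q z by (cases "x \<in> {m, z}") (auto simp: count_mset count_list_0_iff)
    qed
    moreover have "\<not> sorted ?v"
      using v' z by (auto simp: sorted_append)
    ultimately have "formD m w u ?v z (count_list ?v m) (count_list ?v z)"
      using split True \<open>m \<ge> 3 \<and> \<not> sorted w\<close> by (simp add: formD_def)
    then show ?thesis
      by blast
  next
    case False
    have "set q \<subseteq> {z}"
    proof
      fix c assume "c \<in> set q"
      then obtain q1 q2 where q12: "q = q1 @ c # q2"
        by (meson split_list)
      have "m - 1 \<in> set u"
        using set_u True by auto
      then obtain i where i: "i < length u" "u ! i = m - 1"
        by (auto simp: in_set_conv_nth)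
      then have "i < length w"
        using w by simp
      then have "{1..<w ! i} \<subseteq> set (take i w)"
        using assms(1) unfolding restricted_growth_def by blast
      \<comment> \<open>Since \<open>z < m - 1\<close>, restricted growth puts a \<open>z\<close>
        before this \<open>m - 1\<close>, which then serves as the middle letter in place of
        \<open>m\<close>.\<close>
      then have "z \<in> set (take i u)"
        using i w z False by (auto simp: nth_append)
      then obtain u1 u2 where "take i u = u1 @ z # u2"
        by (meson split_list)
      then have "u = u1 @ z # u2 @ (m - 1) # drop (Suc i) u"
        using id_take_nth_drop[OF i(1)] i(2) by simp
      then have "w = u1 @ z # u2 @ (m - 1) # (drop (Suc i) u @ m # p) @ z # q1 @ c # q2"
        using w v' q12 by (metis append.assoc append_Cons)
      then have "c = z \<or> c = m - 1"
        using abac_forbidden[of u1 z u2 "m - 1" "drop (Suc i) u @ m # p" q1 c q2] assms(2) False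
        by auto
      \<comment> \<open>The earlier bound \<open>c \<in> {m, z}\<close> excludes the alternative
        \<open>c = m - 1\<close>.\<close>
      then show "c \<in> {z}"
        using q z False \<open>c \<in> set q\<close> by auto
    qed
    then have "?v = replicate (length (m # p)) m @ replicate (length (z # q)) z"
      using v' by (simp add: replicate_eqI subset_iff)
    then have "formC m w u ?v z (length (m # p)) (length (z # q))"
      using split True z by (simp add: formC_def)
    then show ?thesis
      by blast
  qed
qed

section \<open>Values of the statistics on the forms\<close>

lemma first_max_statistics:
  assumes "restricted_growth w" "m = Max (set w)" "split_at_first_max m w u v"
    and "set v = {m, z}" "z < m"
  defines "a \<equiv> \<lambda>i. int (count_list u i)"
  shows "count_list w m = count_list v m"
    and "int (lb w) = (int m - int z) * int (count_list v z)"
    and "int (rs w) = (\<Sum>i = z + 1..m - 1. a i) + (int (last_position z v) - int (count_list v z))"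
    and "int (rb w) =
      (int (last_position m v) - int (count_list v m)) + (\<Sum>i = 1..m - 1. (int m - int i) * a i)"
    and "int (ls w) =
      (int z - 1) * int (count_list v z) + (\<Sum>i = 2..m - 1. (int i - 1) * a i)
      + (int m - 1) * int (count_list v m)"
proof -
  have w: "w = u @ v" "sorted u" "m \<notin> set u" "v \<noteq> []" "hd v = m"
    using assms(3) by (simp_all add: split_at_first_max_def)
  have set_u: "set u = {1..<m}"
    by (rule set_before_first_max[OF assms(1-3)])
  have set_w: "set w = {1..m}"
    using set_restricted_growth[OF assms(1)] w assms(2) by auto
  have z: "1 \<le> z"
    using set_w w(1) assms(4) by auto
  have u_le: "set u \<subseteq> {1..m - 1}"
    using set_u by auto
  show "count_list w m = count_list v m"
    using w by simp
  show "int (lb w) = (int m - int z) * int (count_list v z)"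
    using lb_append_two_letters[OF w(2) set_u z assms(5), of v] w assms(4,5)
    by (simp add: of_nat_diff)
  show "int (rs w) = (\<Sum>i = z + 1..m - 1. a i) + (int (last_position z v) - int (count_list v z))"
  proof -
    \<comment> \<open>Letters of \<open>u\<close> are below \<open>m\<close>, so \<open>z\<close> is
      the only letter of \<open>v\<close> that can be smaller than \<open>x\<close>.\<close>
    have "card {y \<in> set v. y < x} = of_bool (z < x)" if "x \<in> set u" for x
    proof -
      have "{y \<in> set v. y < x} = (if z < x then {z} else {})"
        using that set_u assms(4,5) by auto
      then show ?thesis
        by simp
    qed
    then have "(\<Sum>x\<leftarrow>u. card {y \<in> set v. y < x}) = (\<Sum>x\<leftarrow>u. of_bool (z < x))"
      by (intro arg_cong[of _ _ sum_list] map_cong) auto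
    also have "int \<dots> = (\<Sum>i = 1..m - 1. int (of_bool (z < i)) * a i)"
      unfolding a_def by (rule sum_list_map_count[OF u_le])
    also have "\<dots> = (\<Sum>i = z + 1..m - 1. a i)"
      using z by (intro sum.mono_neutral_cong_right) auto
    finally show ?thesis
      using rs_append_sorted[OF w(2), of v] rs_two_letters[of z m v] w(1) assms(4,5) by auto
  qed
  show "int (rb w) =
    (int (last_position m v) - int (count_list v m)) + (\<Sum>i = 1..m - 1. (int m - int i) * a i)"
  proof -
    have "rb (u @ v) = (\<Sum>x\<leftarrow>u. m - x) + rb v"
      using set_w w by (intro rb_append_sorted) auto
    moreover have "int (\<Sum>x\<leftarrow>u. m - x) = (\<Sum>i = 1..m - 1. int (m - i) * a i)"
      unfolding a_def by (rule sum_list_map_count[OF u_le])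
    moreover have "\<dots> = (\<Sum>i = 1..m - 1. (int m - int i) * a i)"
      by (intro sum.cong) (auto simp: of_nat_diff)
    ultimately show ?thesis
      using rb_two_letters[of z m v] w(1) assms(4,5) by auto
  qed
  show "int (ls w) =
    (int z - 1) * int (count_list v z) + (\<Sum>i = 2..m - 1. (int i - 1) * a i)
    + (int m - 1) * int (count_list v m)"
  proof -
    have "int (\<Sum>x\<leftarrow>u. x - 1) = (\<Sum>i = 1..m - 1. int (i - 1) * a i)"
      unfolding a_def by (rule sum_list_map_count[OF u_le])
    \<comment> \<open>The term \<open>i = 1\<close> vanishes, and for positive \<open>i\<close> the
      truncated \<open>i - 1\<close> agrees with integer subtraction.\<close>
    also have "\<dots> = (\<Sum>i = 2..m - 1. (int i - 1) * a i)"
      by (intro sum.mono_neutral_cong_right) (auto simp: of_nat_diff)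
    finally have u: "int (\<Sum>x\<leftarrow>u. x - 1) = (\<Sum>i = 2..m - 1. (int i - 1) * a i)" .
    have "(\<Sum>x\<leftarrow>v. x - 1) = (\<Sum>x\<in>{m, z}. count_list v x * (x - 1))"
      using sum_list_map_eq_sum_count[of "\<lambda>x. x - 1" v] assms(4) by simp
    then have "int (\<Sum>x\<leftarrow>v. x - 1) =
        (int m - 1) * int (count_list v m) + (int z - 1) * int (count_list v z)"
      using assms(5) z by (simp add: of_nat_diff mult.commute)
    with u show ?thesis
      using ls_restricted_growth[OF assms(1)] w(1) by simp
  qed
qed

lemma sorted_statistics:
  assumes "restricted_growth w" "w \<noteq> []" "m = Max (set w)" "sorted w"
  shows "lb w = 0" "rs w = 0"
    and "int (rb w) = (\<Sum>i = 1..m - 1. (int m - int i) * int (count_list w i))"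
    and "int (ls w) = (\<Sum>i = 2..m. (int i - 1) * int (count_list w i))"
proof -
  have set_w: "set w = {1..m}"
    using set_restricted_growth[OF assms(1,2)] assms(3) by simp
  show "lb w = 0" "rs w = 0"
    using assms(4) by (simp_all add: lb_sorted rs_sorted)
  \<comment> \<open>A sorted word is all prefix: \<open>rb_append_sorted\<close> applies with
    \<open>v\<close> empty.\<close>
  have "rb (w @ []) = (\<Sum>x\<leftarrow>w. m - x) + rb []"
    using set_w assms(4) by (intro rb_append_sorted) auto
  then have "int (rb w) = (\<Sum>i = 1..m. int (m - i) * int (count_list w i))"
    using sum_list_map_count[of w 1 m "\<lambda>x. m - x"] set_w by simp
  also have "\<dots> = (\<Sum>i = 1..m - 1. (int m - int i) * int (count_list w i))"
    by (intro sum.mono_neutral_cong_right) (auto simp: of_nat_diff)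
  finally show "int (rb w) = (\<Sum>i = 1..m - 1. (int m - int i) * int (count_list w i))" .
  have "int (ls w) = (\<Sum>i = 1..m. int (i - 1) * int (count_list w i))"
    using sum_list_map_count[of w 1 m "\<lambda>x. x - 1"] set_w ls_restricted_growth[OF assms(1)]
    by simp
  also have "\<dots> = (\<Sum>i = 2..m. (int i - 1) * int (count_list w i))"
    by (intro sum.mono_neutral_cong_right) (auto simp: of_nat_diff)
  finally show "int (ls w) = (\<Sum>i = 2..m. (int i - 1) * int (count_list w i))" .
qed

lemma formA_ls:
  assumes "restricted_growth w" "set w \<subseteq> {1, 2}"
  shows "ls w + count_list w 1 = length w"
proof -
  have "(\<Sum>x\<leftarrow>w. x - 1) + count_list w 1 = length w"
    using assms(2) by (induction w) auto
  then show ?thesis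
    using ls_restricted_growth[OF assms(1)] by simp
qed

text \<open>For \<open>lb\<close> the sorted prefix is \<open>replicate i 1\<close>, with
  \<open>m = 2\<close> and \<open>z = 1\<close>. For \<open>rs\<close> and \<open>rb\<close> the
  whole of \<open>w\<close> is treated as a two-letter word and read off from its last
  \<open>1\<close> and last \<open>2\<close>. The identities are additive because subtraction on
  \<open>nat\<close> truncates.\<close>

lemma formA_unsorted_statistics:
  assumes "w = replicate i 1 @ w' @ replicate j 1 @ replicate k 2"
    and "set w \<subseteq> {1, 2}" "1 \<le> i" "1 \<le> j" "w' \<noteq> []" "hd w' = 2" "last w' = 2"
  shows "lb w + i = count_list w 1"
    and "rb w + (if k = 0 then j else 0) = count_list w 1"
    and "rs w + count_list w 1 + k = length w"
proof -
  have len: "length w = count_list w 1 + count_list w 2"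
    using assms(2) by (intro length_two_letters) auto
  have count_replicate: "count_list (replicate r x) y = (if x = y then r else 0)"
    for r and x y :: nat
    by (induction r) auto
  have "set (replicate i 1) = {1..<2::nat}"
    using assms(3) by auto
  then have "lb (replicate i 1 @ w' @ replicate j 1 @ replicate k 2) =
      (2 - 1) * count_list (w' @ replicate j 1 @ replicate k 2) 1"
    using assms by (intro lb_append_two_letters) auto
  then show "lb w + i = count_list w 1"
    using assms(1) by (simp add: count_replicate)
  have last1: "last_position 1 w = length w - k"
  proof -
    obtain j' where "j = Suc j'"
      using assms(4) by (cases j) auto
    then have "w = (replicate i 1 @ w' @ replicate j' 1) @ 1 # replicate k 2"
      using assms(1) by (simp add: replicate_append_same)
    then show ?thesis
      using last_position_append[of 1 "replicate k 2" "replicate i 1 @ w' @ replicate j' 1"]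
      by simp
  qed
  have "1 \<in> set w" "2 \<in> set w" "k \<le> length w"
    using assms(1,4,5,6) hd_in_set[of w'] by auto
  then show "rs w + count_list w 1 + k = length w"
    using rs_two_letters[of 1 2 w] assms(2) last1 by simp
  \<comment> \<open>If \<open>k = 0\<close>, the last \<open>2\<close> ends \<open>w'\<close> and
    exactly \<open>j\<close> letters follow it; otherwise it ends \<open>w\<close>.\<close>
  have last2: "last_position 2 w = length w - (if k = 0 then j else 0)"
  proof (cases k)
    case 0
    have "w' = butlast w' @ [2]"
      using assms(5,7) by (metis append_butlast_last_id)
    then have "w = (replicate i 1 @ butlast w') @ 2 # replicate j 1"
      using assms(1) 0 by (metis append.assoc append.right_neutral append_Cons append_Nil replicate_0)
    then show ?thesis
      using last_position_append[of 2 "replicate j 1" "replicate i 1 @ butlast w'"] 0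
      by simp
  next
    case (Suc k')
    then have "w = (replicate i 1 @ w' @ replicate j 1 @ replicate k' 2) @ [2]"
      using assms(1) by (simp add: replicate_append_same)
    then show ?thesis
      using last_position_append[of 2 "[]" "replicate i 1 @ w' @ replicate j 1 @ replicate k' 2"] Suc
      by simp
  qed
  have "j \<le> length w"
    using assms(1) by simp
  then show "rb w + (if k = 0 then j else 0) = count_list w 1"
    using rb_two_letters[of 1 2 w] assms(2) last2 len \<open>2 \<in> set w\<close> by (auto split: if_splits)
qed

text \<open>In a sorted word each letter \<open>i\<close> has exactly \<open>m - i\<close> distinct
  larger letters to its right, which gives the sum for \<open>rb\<close> under \<open>formB\<close>.
  It differs from the number of \<open>1\<close>s in general: the word 123 has \<open>rb\<close>
  equal to 3. For the same reason a word of \<open>1\<close>s only has \<open>rb\<close> equal to 0,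
  hence the distinction \<open>m = 2\<close> under \<open>formA\<close>. Integers are used so that
  the differences are genuine.\<close>

theorem theorem4p6:
  fixes n m l :: nat and w :: "nat list"
  assumes "w \<in> R n pattern_13_2_4"
    and "w \<noteq> []"
    and "m = Max (set w)"
    and "l = count_list w 1"
  shows
    "(formA m \<or> formB m w \<or>
       (\<exists>u v z bm bz. formC m w u v z bm bz) \<or>
       (\<exists>u v z bm bz. formD m w u v z bm bz))
     \<and>
     (formA m \<longrightarrow>
       int (ls w) = int n - int l \<and>
       (sorted w \<longrightarrow>
          lb w = 0 \<and> rb w = (if m = 2 then l else 0) \<and> rs w = 0) \<and>
       (\<forall>i j k w'. i \<ge> 1 \<and> j \<ge> 1 \<and> w' \<noteq> [] \<and> hd w' = 2 \<and> last w' = 2 \<and>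
          w = replicate i 1 @ w' @ replicate j 1 @ replicate k 2 \<longrightarrow>
          int (lb w) = int l - int i \<and>
          int (rb w) = int l - (if k = 0 then 1 else 0) * int j \<and>
          int (rs w) = int n - int l - int k))
     \<and>
     (formB m w \<longrightarrow>
       (let a = (\<lambda>i. int (count_list w i)) in
          lb w = 0 \<and>
          rs w = 0 \<and>
          int (rb w) = (\<Sum>i = 1..m - 1. (int m - int i) * a i) \<and>
          int (ls w) = (\<Sum>i = 2..m. (int i - 1) * a i)))
     \<and>
     (\<forall>u v z bm bz. formC m w u v z bm bz \<longrightarrow>
       (let a = (\<lambda>i. int (if i = m then bm else count_list u i)) in
          bm = count_list w m \<and>
          int (lb w) = (int m - int z) * int bz \<and>
          int (rs w) = (\<Sum>i = z + 1..m. a i) \<and>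
          int (rb w) = (\<Sum>i = 1..m - 1. (int m - int i) * a i) \<and>
          int (ls w) = (int z - 1) * int bz + (\<Sum>i = 2..m. (int i - 1) * a i)))
     \<and>
     (\<forall>u v z bm bz. formD m w u v z bm bz \<longrightarrow>
       (let a = (\<lambda>i. int (if i = m then bm else count_list u i));
            x = int (last_position m v);
            y = int (last_position z v) in
          bm = count_list w m \<and>
          int (lb w) = (int m - int z) * int bz \<and>
          int (rs w) = y - int bz \<and>
          int (rb w) = (x - a m) + (\<Sum>i = 1..m - 1. (int m - int i) * a i) \<and>
          int (ls w) = (int z - 1) * int bz + (\<Sum>i = 2..m. (int i - 1) * a i)))"
proof -
  note w = R_pattern_13_2_4[OF assms(1)]
  have set_w: "set w = {1..m}"
    using set_restricted_growth[OF w(2) assms(2)] assms(3) by simp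
  have A: "int (ls w) = int n - int l \<and>
       (sorted w \<longrightarrow>
          lb w = 0 \<and> rb w = (if m = 2 then l else 0) \<and> rs w = 0) \<and>
       (\<forall>i j k w'. i \<ge> 1 \<and> j \<ge> 1 \<and> w' \<noteq> [] \<and> hd w' = 2 \<and> last w' = 2 \<and>
          w = replicate i 1 @ w' @ replicate j 1 @ replicate k 2 \<longrightarrow>
          int (lb w) = int l - int i \<and>
          int (rb w) = int l - (if k = 0 then 1 else 0) * int j \<and>
          int (rs w) = int n - int l - int k)" if "formA m"
  proof -
    have m: "m \<le> 2"
      using that by (simp add: formA_def)
    then have letters: "set w \<subseteq> {1, 2}"
      using set_w by auto
    have "m \<noteq> 0"
      using set_w assms(2) by (cases m) auto
    with m have "m = 1 \<or> m = 2"
      by linarith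
    then have "sorted w \<longrightarrow> lb w = 0 \<and> rb w = (if m = 2 then l else 0) \<and> rs w = 0"
      using sorted_statistics[OF w(2) assms(2,3)] assms(4) by auto
    moreover have "int (ls w) = int n - int l"
      using formA_ls[OF w(2) letters] w(1) assms(4) by simp
    moreover have "int (lb w) = int l - int i \<and>
          int (rb w) = int l - (if k = 0 then 1 else 0) * int j \<and>
          int (rs w) = int n - int l - int k"
      if "i \<ge> 1 \<and> j \<ge> 1 \<and> w' \<noteq> [] \<and> hd w' = 2 \<and> last w' = 2 \<and>
          w = replicate i 1 @ w' @ replicate j 1 @ replicate k 2" for i j k w'
      using formA_unsorted_statistics[of w i w' j k] that letters w(1) assms(4)
      by (auto split: if_splits)
    ultimately show ?thesis
      by blast
  qed
  have B: "lb w = 0 \<and> rs w = 0 \<and>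
          int (rb w) = (\<Sum>i = 1..m - 1. (int m - int i) * int (count_list w i)) \<and>
          int (ls w) = (\<Sum>i = 2..m. (int i - 1) * int (count_list w i))" if "formB m w"
    using sorted_statistics[OF w(2) assms(2,3)] that by (simp add: formB_def)
  \<comment> \<open>Splits off the term \<open>i = m\<close>, the only one whose multiplicity is
    read from \<open>v\<close> instead of \<open>u\<close>.\<close>
  have sum_m: "(\<Sum>i = k..m. f i * int (if i = m then b else count_list u i)) =
      (\<Sum>i = k..m - 1. f i * int (count_list u i)) + f m * int b" if km: "k \<le> m" "3 \<le> m"
    for k b u and f :: "nat \<Rightarrow> int"
  proof -
    obtain m' where m': "m = Suc m'"
      using km by (cases m) auto
    then show ?thesis
      using km by (auto intro!: sum.cong)
  qed
  have sum_less_m: "(\<Sum>i = 1..m - 1. f i * int (if i = m then b else count_list u i)) =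
      (\<Sum>i = 1..m - 1. f i * int (count_list u i))" if "3 \<le> m"
    for b u and f :: "nat \<Rightarrow> int"
    using that by (intro sum.cong) auto
  have count_replicate: "count_list (replicate r x) y = (if x = y then r else 0)"
    for r and x y :: nat
    by (induction r) auto
  have C: "bm = count_list w m \<and>
          int (lb w) = (int m - int z) * int bz \<and>
          int (rs w) = (\<Sum>i = z + 1..m. int (if i = m then bm else count_list u i)) \<and>
          int (rb w) = (\<Sum>i = 1..m - 1. (int m - int i) * int (if i = m then bm else count_list u i)) \<and>
          int (ls w) = (int z - 1) * int bz +
            (\<Sum>i = 2..m. (int i - 1) * int (if i = m then bm else count_list u i))"
    if form: "formC m w u v z bm bz" for u v z bm bz
  proof -
    have m: "3 \<le> m" "z < m" and split: "split_at_first_max m w u v"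
      and v: "v = replicate bm m @ replicate bz z" and bz: "1 \<le> bz"
      using form by (auto simp: formC_def)
    \<comment> \<open>With \<open>bm = 0\<close> the word \<open>v\<close> would begin with
      \<open>z\<close>, which is less than \<open>m\<close>.\<close>
    have bm: "1 \<le> bm"
      using split v m bz by (cases bm; cases bz) (auto simp: split_at_first_max_def)
    have set_v: "set v = {m, z}"
      using v bm bz by auto
    have counts: "count_list v m = bm" "count_list v z = bz"
      using v m by (auto simp: count_replicate)
    obtain b c where bc: "bm = Suc b" "bz = Suc c"
      using bm bz by (metis Suc_le_D One_nat_def)
    have "v = replicate b m @ m # replicate bz z"
      using v bc by (simp add: replicate_app_Cons_same)
    \<comment> \<open>The last \<open>m\<close> closes the block of \<open>m\<close>s, so the
      correction \<open>last_position m v - count_list v m\<close> in \<open>rb\<close>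
      vanishes.\<close>
    then have lm: "last_position m v = bm"
      using last_position_append[of m "replicate bz z" "replicate b m"] m bc by simp
    have "v = (replicate bm m @ replicate c z) @ [z]"
      using v bc by (simp add: replicate_append_same)
    \<comment> \<open>The last \<open>z\<close> ends \<open>v\<close>, so
      \<open>last_position z v - bz\<close> equals \<open>bm\<close>, which is the term
      \<open>i = m\<close> of the sum claimed for \<open>rs\<close>.\<close>
    then have lz: "last_position z v = bm + bz"
      using last_position_append[of z "[]" "replicate bm m @ replicate c z"] bc by simp
    show ?thesis
      using first_max_statistics[OF w(2) assms(3) split set_v m(2)] counts lm lz
        sum_m[of "z + 1" "\<lambda>_. 1" bm u] sum_m[of 2 "\<lambda>i. int i - 1" bm u]
        sum_less_m[of "\<lambda>i. int m - int i" bm u] m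
      by simp
  qed
  have D: "bm = count_list w m \<and>
          int (lb w) = (int m - int z) * int bz \<and>
          int (rs w) = int (last_position z v) - int bz \<and>
          int (rb w) = (int (last_position m v) - int bm) +
            (\<Sum>i = 1..m - 1. (int m - int i) * int (if i = m then bm else count_list u i)) \<and>
          int (ls w) = (int z - 1) * int bz +
            (\<Sum>i = 2..m. (int i - 1) * int (if i = m then bm else count_list u i))"
    if form: "formD m w u v z bm bz" for u v z bm bz
  proof -
    have m: "3 \<le> m" "z = m - 1" "z < m" and split: "split_at_first_max m w u v"
      and v: "mset v = replicate_mset bm m + replicate_mset bz z" and "\<not> sorted v"
      using form by (auto simp: formD_def)
    have counts: "count_list v m = bm" "count_list v z = bz"
      using v m(3) by (simp_all flip: count_mset)
    have "set_mset (mset v) \<subseteq> {m, z}"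
      unfolding v by (auto split: if_splits)
    then have sub: "set v \<subseteq> {m, z}"
      by simp
    have "m \<in> set v"
      using split hd_in_set[of v] by (auto simp: split_at_first_max_def)
    moreover have "z \<in> set v"
    proof (rule ccontr)
      assume "z \<notin> set v"
      with sub have "set v \<subseteq> {m}"
        by auto
      then have "sorted v"
        by (induction v) auto
      with \<open>\<not> sorted v\<close> show False ..
    qed
    ultimately have set_v: "set v = {m, z}"
      using sub by auto
    \<comment> \<open>As \<open>z = m - 1\<close>, the sum over \<open>{z + 1..m - 1}\<close> in the
      formula for \<open>rs\<close> is empty and only the last position contributes.\<close>
    show ?thesis
      using first_max_statistics[OF w(2) assms(3) split set_v m(3)] counts
        sum_m[of 2 "\<lambda>i. int i - 1" bm u]
        sum_less_m[of "\<lambda>i. int m - int i" bm u] m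
      by simp
  qed
  show ?thesis
    unfolding Let_def
    using form_classification[OF w(2,3) assms(2,3)] A B C D by simp
qed

end
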